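(* Let $x'\in\Delta$, let $\ell\in\mathbb{R}$ satisfy $\ell\le\ell^*$, where $\ell^*=\min\{f(x)\mid x\in\Delta^c\}$, let $\epsilon>0$, and put $\sigma'=f(x')-\ell+\epsilon$; assume $\sigma'>0$. Let $h(x)=f(x)+\sigma'\lVert Ax-b\rVert^2$, $h^*=\min\{h(x)\mid x\in\{-1,1\}^n\}$ and $f^*=\min\{f(x)\mid x\in\Delta\}$. Then $h^*=f^*$.
   Context: Let $\hat F\in\mathbb{R}^{n\times n}$ be symmetric, $\hat c\in\mathbb{R}^n$, $\hat A\in\mathbb{Z}^{m\times n}$, $\hat b\in\mathbb{Z}^m$. With $e$ the all-ones vector, let $F=\frac14\hat F$, $c=\frac12(\hat c+\hat Fe)$, $\alpha=\frac12\hat c^\top e+\frac14e^\top\hat Fe$, $A=\frac12\hat A$, $b=\hat b-\frac12\hat Ae$. Set $f(x)=x^\top Fx+c^\top x+\alpha$, $\Delta=\{x\in\{-1,1\}^n\mid Ax=b\}$ and $\Delta^c=\{x\in\{-1,1\}^n\mid Ax\neq b\}$. $\lVert\cdot\rVert$ is the Euclidean norm. Convention: $\min\emptyset=+\infty$. *)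

theory Defs
  imports "HOL-Analysis.Analysis"
begin

text \<open>The data after the substitution \<open>x \<mapsto> (x + e) / 2\<close>, which turns a quadratic problem
  over \<open>{0, 1}\<close>-vectors into one over \<open>{-1, 1}\<close>-vectors. Here \<open>1\<close> at a vector type is the
  all-ones vector \<open>e\<close>.\<close>

definition pm_F :: "real^'n^'n \<Rightarrow> real^'n^'n" where
  "pm_F Fh = (1/4) *\<^sub>R Fh"

definition pm_c :: "real^'n^'n \<Rightarrow> real^'n \<Rightarrow> real^'n" where
  "pm_c Fh ch = (1/2) *\<^sub>R (ch + Fh *v 1)"

definition pm_alpha :: "real^'n^'n \<Rightarrow> real^'n \<Rightarrow> real" where
  "pm_alpha Fh ch = (1/2) * (ch \<bullet> 1) + (1/4) * (1 \<bullet> (Fh *v 1))"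

definition pm_A :: "int^'n^'m \<Rightarrow> real^'n^'m" where
  "pm_A Ah = (1/2) *\<^sub>R map_matrix real_of_int Ah"

definition pm_b :: "int^'n^'m \<Rightarrow> int^'m \<Rightarrow> real^'m" where
  "pm_b Ah bh = (\<chi> i. real_of_int (bh $ i)) - (1/2) *\<^sub>R (map_matrix real_of_int Ah *v 1)"

definition objective :: "real^'n^'n \<Rightarrow> real^'n \<Rightarrow> real^'n \<Rightarrow> real" where
  "objective Fh ch x = x \<bullet> (pm_F Fh *v x) + pm_c Fh ch \<bullet> x + pm_alpha Fh ch"

definition pm_cube :: "(real^'n) set" where
  "pm_cube = {x. \<forall>i. x $ i \<in> {-1, 1}}"

definition feasible :: "int^'n^'m \<Rightarrow> int^'m \<Rightarrow> (real^'n) set" where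
  "feasible Ah bh = {x \<in> pm_cube. pm_A Ah *v x = pm_b Ah bh}"

definition infeasible :: "int^'n^'m \<Rightarrow> int^'m \<Rightarrow> (real^'n) set" where
  "infeasible Ah bh = {x \<in> pm_cube. pm_A Ah *v x \<noteq> pm_b Ah bh}"

definition penalized ::
  "real^'n^'n \<Rightarrow> real^'n \<Rightarrow> int^'n^'m \<Rightarrow> int^'m \<Rightarrow> real \<Rightarrow> real^'n \<Rightarrow> real" where
  "penalized Fh ch Ah bh \<sigma> x = objective Fh ch x + \<sigma> * (norm (pm_A Ah *v x - pm_b Ah bh))\<^sup>2"

text \<open>Minimum over a finite set; the value is extended real so that the minimum over the empty
  set can be \<open>\<infinity>\<close>. On infinite sets it is meaningless, as \<^const>\<open>Min\<close> is; it is only used on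
  subsets of the finite set \<^const>\<open>pm_cube\<close>.\<close>

definition min_value :: "('a \<Rightarrow> real) \<Rightarrow> 'a set \<Rightarrow> ereal" where
  "min_value g S = (if S = {} then \<infinity> else ereal (Min (g ` S)))"

lemma finite_pm_cube: "finite (pm_cube :: (real^'n) set)"
proof -
  have "finite (Pi\<^sub>E (UNIV :: 'n set) (\<lambda>_. {-1, 1 :: real}))"
    by (intro finite_PiE) auto
  moreover have "pm_cube \<subseteq> vec_lambda ` Pi\<^sub>E (UNIV :: 'n set) (\<lambda>_. {-1, 1 :: real})"
  proof
    fix x :: "real^'n"
    assume "x \<in> pm_cube"
    then have "vec_nth x \<in> Pi\<^sub>E UNIV (\<lambda>_. {-1, 1})"
      by (auto simp: pm_cube_def)
    then show "x \<in> vec_lambda ` Pi\<^sub>E UNIV (\<lambda>_. {-1, 1})"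
      by (metis image_eqI vec_nth_inverse)
  qed
  ultimately show ?thesis
    by (rule rev_finite_subset[OF finite_imageI])
qed

end

theory Submission
  imports Defs
begin

text \<open>On a point of the cube the residual \<open>A x - b\<close> equals \<open>Ah ((x + e) / 2) - bh\<close>, an integer
  vector, so its squared norm is at least 1 at every infeasible point. There the penalized
  objective is thus at least \<open>l + \<sigma>' > f x'\<close>, and the minimum is attained at a feasible point, where
  the penalty vanishes.\<close>

text \<open>Undoing the substitution: \<open>(x $ j + 1) / 2\<close> is the original 0-1 variable,
  and the half-integral shift in \<open>pm_b\<close> is absorbed into it. In this form integrality
  on the cube can be read off termwise.\<close>

lemma residual_eq:
  "(pm_A Ah *v x - pm_b Ah bh) $ i
     = (\<Sum>j\<in>UNIV. of_int (Ah $ i $ j) * ((x $ j + 1) / 2)) - of_int (bh $ i)"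
proof -
  have "(\<Sum>j\<in>UNIV. of_int (Ah $ i $ j) * ((x $ j + 1) / 2))
      = (\<Sum>j\<in>UNIV. of_int (Ah $ i $ j) / 2 * x $ j) + (\<Sum>j\<in>UNIV. of_int (Ah $ i $ j)) / 2"
    unfolding sum_divide_distrib sum.distrib[symmetric]
    by (intro sum.cong) (auto simp: field_simps)
  then show ?thesis
    by (simp add: pm_A_def pm_b_def matrix_vector_mult_def map_matrix_def)
qed

lemma residual_Ints:
  assumes "x \<in> pm_cube"
  shows "(pm_A Ah *v x - pm_b Ah bh) $ i \<in> \<int>"
proof -
  \<comment> \<open>On the cube this quotient is 0 or 1.\<close>
  have "(x $ j + 1) / 2 \<in> \<int>" for j
  proof -
    have "x $ j = -1 \<or> x $ j = 1"
      using assms by (auto simp: pm_cube_def)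
    then show ?thesis by (elim disjE) simp_all
  qed
  then show ?thesis
    unfolding residual_eq by (intro Ints_diff Ints_sum Ints_mult Ints_of_int)
qed

text \<open>Some coordinate is a nonzero integer, hence at least 1 in absolute value, and the
  Euclidean norm dominates every coordinate.\<close>

lemma norm_Ints_vector_ge_1:
  fixes v :: "real^'n"
  assumes "\<And>i. v $ i \<in> \<int>" and "v \<noteq> 0"
  shows "1 \<le> norm v"
proof -
  obtain i where "v $ i \<noteq> 0"
    using assms(2) by (auto simp: vec_eq_iff)
  then have "1 \<le> \<bar>v $ i\<bar>"
    using assms(1) by (rule Ints_nonzero_abs_ge1[rotated])
  also have "\<dots> \<le> norm v"
    by (rule component_le_norm_cart)
  finally show ?thesis .
qed

lemma penalized_feasible:
  assumes "x \<in> feasible Ah bh"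
  shows "penalized Fh ch Ah bh \<sigma> x = objective Fh ch x"
  using assms by (simp add: feasible_def penalized_def)

lemma penalized_infeasible_ge:
  assumes "x \<in> infeasible Ah bh" and "0 \<le> \<sigma>"
  shows "objective Fh ch x + \<sigma> \<le> penalized Fh ch Ah bh \<sigma> x"
proof -
  have "1 \<le> norm (pm_A Ah *v x - pm_b Ah bh)"
    using assms(1) by (intro norm_Ints_vector_ge_1 residual_Ints) (auto simp: infeasible_def)
  then have "1 \<le> (norm (pm_A Ah *v x - pm_b Ah bh))\<^sup>2"
    by (rule one_le_power)
  then have "\<sigma> * 1 \<le> \<sigma> * (norm (pm_A Ah *v x - pm_b Ah bh))\<^sup>2"
    using assms(2) by (rule mult_left_mono)
  then show ?thesis
    by (simp add: penalized_def)
qed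

lemma min_value_le:
  assumes "finite S" and "x \<in> S"
  shows "min_value g S \<le> ereal (g x)"
  using assms by (auto simp: min_value_def)

text \<open>The witness \<open>y\<close> bounds \<open>h\<close> from below outside
  \<open>T\<close>, so points of \<open>S - T\<close> cannot push the minimum below that of
  \<open>g\<close> on \<open>T\<close>. Being in \<open>T\<close>, it also makes both sets nonempty,
  which excludes the value \<infinity>.\<close>

lemma min_value_eq_subset:
  assumes "finite S" and "T \<subseteq> S" and "y \<in> T"
    and "\<And>x. x \<in> T \<Longrightarrow> h x = g x"
    and "\<And>x. x \<in> S - T \<Longrightarrow> g y \<le> h x"
  shows "min_value h S = min_value g T"
proof -
  have fin: "finite T"
    using assms(1,2) finite_subset by blast
  have "Min (h ` S) = Min (g ` T)"
  proof (rule Min_eqI)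
    show "finite (h ` S)"
      using assms(1) by simp
    have "Min (g ` T) \<in> g ` T"
      using fin assms(3) by (intro Min_in) auto
    \<comment> \<open>A minimizer of \<open>g\<close> on \<open>T\<close> lies in \<open>S\<close>,
      and \<open>h\<close> takes the same value there.\<close>
    then show "Min (g ` T) \<in> h ` S"
      using assms(2,4) by force
  next
    fix z assume "z \<in> h ` S"
    then obtain x where x: "x \<in> S" "z = h x" by blast
    show "Min (g ` T) \<le> z"
    proof (cases "x \<in> T")
      case True
      then show ?thesis using fin x assms(4) by simp
    next
      case False
      have "Min (g ` T) \<le> g y" using fin assms(3) by simp
      also have "\<dots> \<le> z" using False x assms(5) by simp
      finally show ?thesis .
    qed
  qed
  then show ?thesis
    using assms(2,3) by (auto simp: min_value_def)
qed

theorem theorem15: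
  fixes Fh :: "real^'n^'n" and ch :: "real^'n"
    and Ah :: "int^'n^'m" and bh :: "int^'m"
    and x' :: "real^'n" and l \<epsilon> \<sigma>' :: real
  assumes "transpose Fh = Fh"
    and "x' \<in> feasible Ah bh"
    and "ereal l \<le> min_value (objective Fh ch) (infeasible Ah bh)"
    and "\<epsilon> > 0"
    and "\<sigma>' = objective Fh ch x' - l + \<epsilon>"
    and "\<sigma>' > 0"
  shows "min_value (penalized Fh ch Ah bh \<sigma>') pm_cube
           = min_value (objective Fh ch) (feasible Ah bh)"
proof (rule min_value_eq_subset)
  show "finite (pm_cube :: (real^'n) set)"
    by (rule finite_pm_cube)
  show "feasible Ah bh \<subseteq> pm_cube"
    by (auto simp: feasible_def)
  \<comment> \<open>The known feasible point serves as the witness \<open>y\<close>.\<close>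
  show "x' \<in> feasible Ah bh"
    by (rule assms(2))
  show "penalized Fh ch Ah bh \<sigma>' x = objective Fh ch x" if "x \<in> feasible Ah bh" for x
    using that by (rule penalized_feasible)
next
  fix x assume "x \<in> pm_cube - feasible Ah bh"
  then have x: "x \<in> infeasible Ah bh"
    by (auto simp: feasible_def infeasible_def)
  have "finite (infeasible Ah bh)"
    using finite_pm_cube by (rule rev_finite_subset) (auto simp: infeasible_def)
  then have "min_value (objective Fh ch) (infeasible Ah bh) \<le> ereal (objective Fh ch x)"
    using x by (rule min_value_le)
  with assms(3) have "ereal l \<le> ereal (objective Fh ch x)"
    by (rule order_trans)
  moreover have "objective Fh ch x + \<sigma>' \<le> penalized Fh ch Ah bh \<sigma>' x"
    using x assms(6) by (intro penalized_infeasible_ge) auto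
  \<comment> \<open>By the choice of \<open>\<sigma>'\<close>, the lower bound
    \<open>l + \<sigma>'\<close> equals \<open>objective Fh ch x' + \<epsilon>\<close>.\<close>
  ultimately show "objective Fh ch x' \<le> penalized Fh ch Ah bh \<sigma>' x"
    using assms(4,5) by simp
qed

end
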